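(* Let $\mathrm{F}$ be a field with $\operatorname{char}\mathrm{F}\neq 2$, let $J_1$ be a perfect Jordan algebra over $\mathrm{F}$, let $J_2$ be an arbitrary Jordan algebra over $\mathrm{F}$, and let $f:J_1\to J_2$ be a triple homomorphism satisfying $Ann_f(J_2)=\{0\}$. Then $f$ is a homomorphism (i.e. $f(x\circ y)=f(x)\circ f(y)$ for all $x,y\in J_1$) if and only if $f(x^2)=(f(x))^2$ for all $x\in J_1$.
   Context: A Jordan algebra $J$ over a field $\mathrm{F}$ is an $\mathrm{F}$-algebra with product $\circ$ satisfying $x\circ y=y\circ x$ and $(x^2\circ y)\circ x=x^2\circ(x\circ y)$ for all $x,y\in J$, where $x^2=x\circ x$. The derived algebra $J'$ is the linear span of all products $x\circ y$ with $x,y\in J$; $J$ is perfect if $J=J'$. A triple homomorphism between Jordan algebras $J_1,J_2$ is a linear map $f:J_1\to J_2$ with $f((x\circ y)\circ z)=(f(x)\circ f(y))\circ f(z)$ for all $x,y,z\in J_1$. For such $f$, $Ann_f(J_2)=\{a\in J_2\mid a\circ f(x)=0\ \forall x\in J_1\}$. *)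

theory Defs
  imports Complex_Main
begin

text \<open>Algebras are not assumed unital, nor finite-dimensional. The carrier is the whole
  type \<^typ>\<open>'a\<close>; the scalar action and the product are explicit parameters.\<close>

locale jordan_algebra = vector_space scale
  for scale :: "'f::field \<Rightarrow> 'a::ab_group_add \<Rightarrow> 'a" +
  fixes jmult :: "'a \<Rightarrow> 'a \<Rightarrow> 'a" (infixl "\<diamondop>" 70)
  assumes linear_left: "\<And>y. Vector_Spaces.linear scale scale (\<lambda>x. x \<diamondop> y)"
    and linear_right: "\<And>x. Vector_Spaces.linear scale scale (\<lambda>y. x \<diamondop> y)"
    and commute: "\<And>x y. x \<diamondop> y = y \<diamondop> x"
    and jordan_identity: "\<And>x y. ((x \<diamondop> x) \<diamondop> y) \<diamondop> x = (x \<diamondop> x) \<diamondop> (x \<diamondop> y)"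

definition derived_algebra ::
    "('f::field \<Rightarrow> 'a::ab_group_add \<Rightarrow> 'a) \<Rightarrow> ('a \<Rightarrow> 'a \<Rightarrow> 'a) \<Rightarrow> 'a set" where
  "derived_algebra scale jmult = module.span scale {jmult x y | x y. True}"

definition perfect_algebra ::
    "('f::field \<Rightarrow> 'a::ab_group_add \<Rightarrow> 'a) \<Rightarrow> ('a \<Rightarrow> 'a \<Rightarrow> 'a) \<Rightarrow> bool" where
  "perfect_algebra scale jmult \<longleftrightarrow> derived_algebra scale jmult = UNIV"

definition triple_hom ::
    "('f::field \<Rightarrow> 'a::ab_group_add \<Rightarrow> 'a) \<Rightarrow> ('a \<Rightarrow> 'a \<Rightarrow> 'a) \<Rightarrow>
     ('f \<Rightarrow> 'b::ab_group_add \<Rightarrow> 'b) \<Rightarrow> ('b \<Rightarrow> 'b \<Rightarrow> 'b) \<Rightarrow> ('a \<Rightarrow> 'b) \<Rightarrow> bool" where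
  "triple_hom scale1 jmult1 scale2 jmult2 f \<longleftrightarrow>
     Vector_Spaces.linear scale1 scale2 f \<and>
     (\<forall>x y z. f (jmult1 (jmult1 x y) z) = jmult2 (jmult2 (f x) (f y)) (f z))"

definition Ann :: "('b \<Rightarrow> 'b \<Rightarrow> 'b::zero) \<Rightarrow> ('a \<Rightarrow> 'b) \<Rightarrow> 'b set" where
  "Ann jmult2 f = {a. \<forall>x. jmult2 a (f x) = 0}"

end

theory Submission
  imports Defs
begin

text \<open>Polarization. The forward implication is the diagonal case \<open>y = x\<close>.
  Conversely, a commutative bilinear product is recovered from its squares: 2(x y) = (x + y)^2 - x^2
  - y^2. A linear \<open>f\<close> that preserves squares thus preserves twice every product
  (\<open>square_add\<close>), and in characteristic other than 2 the factor 2 cancels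
  (\<open>eq_zero_if_double_eq_zero\<close>).\<close>

lemma (in vector_space) eq_zero_if_double_eq_zero:
  fixes x :: 'b
  assumes "CHAR('a) \<noteq> 2" and "x + x = 0"
  shows "x = 0"
proof -
  have "(of_nat 2 :: 'a) \<noteq> 0"
  proof
    assume "(of_nat 2 :: 'a) = 0"
    \<comment> \<open>A divisor of 2 is 1 or 2: \<open>CHAR('a)\<close> cannot be 0, as 0 does not
      divide 2, nor 1, as a field has 1 \<noteq> 0.\<close>
    then have "CHAR('a) dvd 2"
      by (simp only: of_nat_eq_0_iff_char_dvd)
    then have "CHAR('a) \<le> 2" and "CHAR('a) > 0"
      by (auto dest: dvd_imp_le dvd_pos_nat[rotated])
    with assms(1) CHAR_not_1[where 'a='a] show False
      by linarith
  qed
  moreover have "scale (of_nat 2) x = 0"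
    using assms(2) scale_left_distrib[of 1 1 x] by simp
  ultimately show ?thesis
    by (simp only: scale_eq_0_iff) simp
qed

text \<open>The bracketing keeps both squares together as the left summand, so that they cancel at
  once; commutativity merges the cross terms.\<close>

lemma (in jordan_algebra) square_add:
  "(x + y) \<diamondop> (x + y) = x \<diamondop> x + y \<diamondop> y + (x \<diamondop> y + x \<diamondop> y)"
proof -
  have "(u + v) \<diamondop> w = u \<diamondop> w + v \<diamondop> w" and "w \<diamondop> (u + v) = w \<diamondop> u + w \<diamondop> v" for u v w
    using linear_left[of w] linear_right[of w]
    by (simp_all add: Vector_Spaces.linear_iff)
  then show ?thesis
    by (simp add: commute[of y x] ac_simps)
qed

theorem corollary3p4:
  fixes scale1 :: "'f::field \<Rightarrow> 'a::ab_group_add \<Rightarrow> 'a"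
    and jmult1 :: "'a \<Rightarrow> 'a \<Rightarrow> 'a"
    and scale2 :: "'f \<Rightarrow> 'b::ab_group_add \<Rightarrow> 'b"
    and jmult2 :: "'b \<Rightarrow> 'b \<Rightarrow> 'b"
    and f :: "'a \<Rightarrow> 'b"
  assumes char: "CHAR('f) \<noteq> 2"
    and J1: "jordan_algebra scale1 jmult1"
    and J2: "jordan_algebra scale2 jmult2"
    and perfect: "perfect_algebra scale1 jmult1"
    and triple: "triple_hom scale1 jmult1 scale2 jmult2 f"
    and ann: "Ann jmult2 f = {0}"
  shows "(\<forall>x y. f (jmult1 x y) = jmult2 (f x) (f y)) \<longleftrightarrow>
         (\<forall>x. f (jmult1 x x) = jmult2 (f x) (f x))"
proof (intro iffI allI)
  fix x y
  assume sq: "\<forall>x. f (jmult1 x x) = jmult2 (f x) (f x)"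
  interpret J1: jordan_algebra scale1 jmult1 by (rule J1)
  interpret J2: jordan_algebra scale2 jmult2 by (rule J2)
  interpret f: Vector_Spaces.linear scale1 scale2 f
    using triple by (simp add: triple_hom_def)
  have "f (jmult1 (x + y) (x + y)) = jmult2 (f x + f y) (f x + f y)"
    unfolding f.add[symmetric] by (rule sq[rule_format])
  then have "f (jmult1 x y) + f (jmult1 x y) = jmult2 (f x) (f y) + jmult2 (f x) (f y)"
    \<comment> \<open>By \<open>sq\<close> at \<open>x\<close> and \<open>y\<close>, the square
      parts of both sides agree and cancel, leaving the doubled cross terms.\<close>
    unfolding J1.square_add J2.square_add f.add sq[rule_format] add_left_cancel .
  then have "(f (jmult1 x y) - jmult2 (f x) (f y)) + (f (jmult1 x y) - jmult2 (f x) (f y)) = 0"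
    by (simp add: algebra_simps)
  then have "f (jmult1 x y) - jmult2 (f x) (f y) = 0"
    by (rule J2.eq_zero_if_double_eq_zero[OF char])
  then show "f (jmult1 x y) = jmult2 (f x) (f y)"
    by simp
qed simp

end
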